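(* For every $n\ge2$, the triple of statistics $(\mathbf{F},\mathbf{spi},\mathbf{NL})$ on $\mathrm{And}_n^{I}$ and the triple $(\mathbf{pit},\mathbf{L},\mathbf{grn})$ on $\mathrm{And}_n^{II}$ are equidistributed: for all integers $p,q,r$, $\#\{w\in\mathrm{And}_n^{I}:(\mathbf{F}\,w,\mathbf{spi}\,w,\mathbf{NL}\,w)=(p,q,r)\}=\#\{w\in\mathrm{And}_n^{II}:(\mathbf{pit}\,w,\mathbf{L}\,w,\mathbf{grn}\,w)=(p,q,r)\}$.
   Context: Words $w=x_1\cdots x_n$ are permutations of finite sets $Y$ of positive integers. Andr\'e permutations: the empty word and one-letter words are Andr\'e I and II; for $|Y|\ge2$ write $w=v\,\min(w)\,v'$; $w$ is Andr\'e I (resp. II) if $v,v'$ are Andr\'e I (resp. II) and $\max(vv')$ (resp. $\min(vv')$) is a letter of $v'$. $\mathrm{And}_n^{I}$, $\mathrm{And}_n^{II}$: Andr\'e I, II permutations of $\{1,\dots,n\}$. Statistics for $w=x_1\cdots x_n$, $n\ge2$: $\mathbf{F}\,w=x_1$; $\mathbf{L}\,w=x_n$; $\mathbf{NL}\,w=x_{n-1}$; $\mathbf{grn}\,w=\max\{x_{i-1},x_{i+1}\}$ where $x_i$ is the maximum letter, with $x_0=x_{n+1}=0$; $\mathbf{spi}\,w$ (spike) is the letter $x_i$ ($1\le i\le n$) such that $x_1\le x_j$ for all $j\le i$ and $x_1>x_{i+1}$, with the convention $x_{n+1}=0$; $\mathbf{pit}\,w$ (pit) is defined for words with $x_{n-1}<x_n$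 recursively: if $w$ ends with its maximum letter, $\mathbf{pit}\,w=\min(w)$; otherwise write $w=w_1\,\min(w)\,w_2$ and set $\mathbf{pit}\,w=\mathbf{pit}\,w_2$ (a one-letter $w_2$ ends with its maximum). *)

theory Defs
  imports "HOL-Combinatorics.Multiset_Permutations"
begin

text \<open>Words are lists of positive natural numbers without repeated letters.\<close>

inductive andreI :: "nat list \<Rightarrow> bool" where
  empty: "andreI []"
| single: "andreI [x]"
| split: "\<lbrakk>distinct (v @ m # v'); v @ v' \<noteq> []; m = Min (set (v @ m # v'));
           andreI v; andreI v'; Max (set (v @ v')) \<in> set v'\<rbrakk>
          \<Longrightarrow> andreI (v @ m # v')"

inductive andreII :: "nat list \<Rightarrow> bool" where
  empty: "andreII []"
| single: "andreII [x]"
| split: "\<lbrakk>distinct (v @ m # v'); v @ v' \<noteq> []; m = Min (set (v @ m # v'));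
           andreII v; andreII v'; Min (set (v @ v')) \<in> set v'\<rbrakk>
          \<Longrightarrow> andreII (v @ m # v')"

definition AndI :: "nat \<Rightarrow> nat list set" where
  "AndI n = {w \<in> permutations_of_set {1..n}. andreI w}"

definition AndII :: "nat \<Rightarrow> nat list set" where
  "AndII n = {w \<in> permutations_of_set {1..n}. andreII w}"

text \<open>\<open>letter w i\<close> is $x_i$ for $w = x_1 \cdots x_n$, extended by $x_0 = x_{n+1} = 0$.\<close>

definition letter :: "nat list \<Rightarrow> nat \<Rightarrow> nat" where
  "letter w i = (if 1 \<le> i \<and> i \<le> length w then w ! (i - 1) else 0)"

definition F_stat :: "nat list \<Rightarrow> nat" where
  "F_stat w = letter w 1"

definition L_stat :: "nat list \<Rightarrow> nat" where
  "L_stat w = letter w (length w)"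

definition NL_stat :: "nat list \<Rightarrow> nat" where
  "NL_stat w = letter w (length w - 1)"

definition grn :: "nat list \<Rightarrow> nat" where
  "grn w = (let i = (THE i. i \<in> {1..length w} \<and> letter w i = Max (set w))
            in max (letter w (i - 1)) (letter w (i + 1)))"

definition is_spike_pos :: "nat list \<Rightarrow> nat \<Rightarrow> bool" where
  "is_spike_pos w i \<longleftrightarrow> i \<in> {1..length w} \<and>
     (\<forall>j\<in>{1..i}. letter w 1 \<le> letter w j) \<and> letter w 1 > letter w (i + 1)"

definition spi :: "nat list \<Rightarrow> nat" where
  "spi w = letter w (THE i. is_spike_pos w i)"

text \<open>
  The argument of the recursive call is $w_2$ in $w = w_1 \min(w)\, w_2$. The value at
  the empty word is junk: it is never reached from a one-letter word or from a word
  whose last letter exceeds its next-to-last letter.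
\<close>

function pit :: "nat list \<Rightarrow> nat" where
  "pit w = (if w = [] then 0
            else if last w = Max (set w) then Min (set w)
            else pit (tl (dropWhile (\<lambda>x. x \<noteq> Min (set w)) w)))"
  by auto

termination
proof (relation "measure length", goal_cases)
  case (2 w)
  have "length (dropWhile (\<lambda>x. x \<noteq> Min (set w)) w) \<le> length w"
    by (rule length_dropWhile_le)
  with 2 show ?case
    by (cases w) auto
qed auto

declare pit.simps [simp del]

lemma pit_max_last:
  assumes "w \<noteq> []" "last w = Max (set w)"
  shows "pit w = Min (set w)"
  using assms by (subst pit.simps) simp

lemma pit_split:
  assumes "w = w1 @ Min (set w) # w2" "distinct w" "last w \<noteq> Max (set w)"
  shows "pit w = pit w2"
proof -
  define m where "m = Min (set w)"
  have w: "w = w1 @ m # w2"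
    using assms(1) by (simp add: m_def)
  have "m \<notin> set w1"
    using assms(2) w by auto
  then have "dropWhile (\<lambda>x. x \<noteq> m) w = m # w2"
    unfolding w by (subst dropWhile_append2) auto
  moreover have "w \<noteq> []"
    using w by simp
  ultimately show ?thesis
    using assms(3) by (subst pit.simps) (simp add: m_def)
qed

lemma ex1_spike_pos:
  assumes "w \<noteq> []" "0 \<notin> set w"
  shows "\<exists>!i. is_spike_pos w i"
proof -
  define P where "P = (\<lambda>i. 1 \<le> i \<and> letter w (i + 1) < letter w 1)"
  define k where "k = (LEAST i. P i)"
  have pos: "letter w 1 > 0"
    using assms by (cases w) (auto simp: letter_def)
  have Pn: "P (length w)"
    using assms(1) pos by (cases w) (auto simp: P_def letter_def)
  have Pk: "P k"
    unfolding k_def using Pn by (rule LeastI)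
  have k_le: "k \<le> length w"
    unfolding k_def using Pn by (rule Least_le)
  have ge: "letter w 1 \<le> letter w j" if "1 \<le> j" "j \<le> k" for j
  proof (cases "j = 1")
    case False
    then have "j - 1 < k" using that by linarith
    then have "\<not> P (j - 1)"
      unfolding k_def by (rule not_less_Least)
    then show ?thesis
      using False that by (auto simp: P_def)
  qed simp
  show ?thesis
  proof (rule ex1I)
    show "is_spike_pos w k"
      using Pk k_le ge by (auto simp: is_spike_pos_def P_def)
  next
    fix i assume i: "is_spike_pos w i"
    then have "P i" by (auto simp: is_spike_pos_def P_def)
    then have "k \<le> i" unfolding k_def by (rule Least_le)
    moreover have "\<not> k < i"
    proof
      assume "k < i"
      then have "letter w 1 \<le> letter w (k + 1)"
        using i by (auto simp: is_spike_pos_def)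
      then show False using Pk by (simp add: P_def)
    qed
    ultimately show "i = k" by simp
  qed
qed

end

theory Submission
  imports Defs "HOL-Library.Tree"
begin

text \<open>
  Splitting at the minimum turns an Andr\'e permutation of either type into an increasing binary
  tree; forgetting the order of siblings, both types encode the same trees, the sibling on the
  right being the one with the larger maximum (type I) or with the smaller root (type II).

  In type I order the right spine \<open>r\<^sub>0 < \<dots> < r\<^sub>k\<close> ends in the maximum; let \<open>B\<^sub>i\<close> be the subtree
  hanging to the left of \<open>r\<^sub>i\<close>. The pair (F, spi) equals (root, maximum) if \<open>B\<^sub>0\<close> is empty and is
  inherited from \<open>B\<^sub>0\<close> otherwise. The pair (pit, L) equals (root, maximum) if the type II walk to
  the smaller child follows the spine to its end, and is inherited from the side tree at which the
  walk first leaves the spine otherwise. So move \<open>B\<^sub>0\<close> down to the unique \<open>r\<^sub>i\<close> with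
  \<open>r\<^sub>i < root B\<^sub>0 < r\<^sub>i\<^sub>+\<^sub>1\<close> (to the end of the spine if \<open>B\<^sub>0\<close> is empty), shift \<open>B\<^sub>1, \<dots>, B\<^sub>i\<close> up by
  one place, and treat \<open>B\<^sub>0\<close> recursively. This is injective and takes (F, spi) to (pit, L). The
  spine is unchanged, and so is the parent of the maximum, which is NL in type I and grn in type II.
\<close>

section \<open>Trees ordered by a relation between the label sets of siblings\<close>

text \<open>A leaf has no labels and counts as the earlier sibling, here and in
  \<open>min_less\<close>, so an only child is the right child in both types.\<close>

definition max_less :: "nat set \<Rightarrow> nat set \<Rightarrow> bool" where
  "max_less A B \<longleftrightarrow> A = {} \<or> B \<noteq> {} \<and> Max A < Max B"

definition min_less :: "nat set \<Rightarrow> nat set \<Rightarrow> bool" where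
  "min_less A B \<longleftrightarrow> A = {} \<or> B \<noteq> {} \<and> Min B < Min A"

fun andre_tree :: "(nat set \<Rightarrow> nat set \<Rightarrow> bool) \<Rightarrow> nat tree \<Rightarrow> bool" where
  "andre_tree lt \<langle>\<rangle> \<longleftrightarrow> True"
| "andre_tree lt \<langle>l, x, r\<rangle> \<longleftrightarrow>
     (\<forall>y \<in> set_tree l \<union> set_tree r. x < y) \<and> set_tree l \<inter> set_tree r = {} \<and>
     lt (set_tree l) (set_tree r) \<and> andre_tree lt l \<and> andre_tree lt r"

fun sort_tree :: "(nat set \<Rightarrow> nat set \<Rightarrow> bool) \<Rightarrow> nat tree \<Rightarrow> nat tree" where
  "sort_tree lt \<langle>\<rangle> = \<langle>\<rangle>"
| "sort_tree lt \<langle>l, x, r\<rangle> =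
     (if lt (set_tree l) (set_tree r) then \<langle>sort_tree lt l, x, sort_tree lt r\<rangle>
      else \<langle>sort_tree lt r, x, sort_tree lt l\<rangle>)"

text \<open>Totality lets every node be sorted. Both directions can hold only between two leaves,
  where a swap changes nothing.\<close>

definition sibling_order :: "(nat set \<Rightarrow> nat set \<Rightarrow> bool) \<Rightarrow> bool" where
  "sibling_order lt \<longleftrightarrow> (\<forall>A B. finite A \<longrightarrow> finite B \<longrightarrow> A \<inter> B = {} \<longrightarrow>
     (lt A B \<or> lt B A) \<and> (lt A B \<longrightarrow> lt B A \<longrightarrow> A = {} \<and> B = {}))"

lemma sibling_order_max_less: "sibling_order max_less"
proof -
  have "Max A \<noteq> Max B" if "finite A" "finite B" "A \<inter> B = {}" "A \<noteq> {}" "B \<noteq> {}" for A B :: "nat set"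
    using that Max_in[of A] Max_in[of B] by (metis disjoint_iff)
  then show ?thesis
    unfolding sibling_order_def max_less_def by (meson less_asym linorder_neqE_nat)
qed

lemma sibling_order_min_less: "sibling_order min_less"
proof -
  have "Min A \<noteq> Min B" if "finite A" "finite B" "A \<inter> B = {}" "A \<noteq> {}" "B \<noteq> {}" for A B :: "nat set"
    using that Min_in[of A] Min_in[of B] by (metis disjoint_iff)
  then show ?thesis
    unfolding sibling_order_def min_less_def by (meson less_asym linorder_neqE_nat)
qed

lemma set_sort_tree [simp]: "set_tree (sort_tree lt t) = set_tree t"
  by (induction t) auto

lemma andre_tree_sort_tree:
  assumes "sibling_order lt" "andre_tree lt' t"
  shows "andre_tree lt (sort_tree lt t)"
  using assms(2)
proof (induction t)
  case (Node l x r)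
  then have "lt (set_tree l) (set_tree r) \<or> lt (set_tree r) (set_tree l)"
    using assms(1) by (simp add: sibling_order_def)
  with Node show ?case by auto
qed simp

text \<open>Sorting looks only at label sets, which an earlier sorting preserves, so the original
  order is restored at each node. Hence sorting by the two orders gives mutually inverse maps
  between the types.\<close>

lemma sort_tree_sort_tree:
  assumes "sibling_order lt" "andre_tree lt t"
  shows "sort_tree lt (sort_tree lt' t) = t"
  using assms(2)
proof (induction t)
  case (Node l x r)
  have "l = \<langle>\<rangle> \<and> r = \<langle>\<rangle>" if "lt (set_tree r) (set_tree l)"
    using that assms(1) Node.prems unfolding sibling_order_def
    by (metis andre_tree.simps(2) eq_set_tree_empty finite_set_tree)
  with Node show ?case by auto
qed simp

lemma distinct_inorder_andre_tree: "andre_tree lt t \<Longrightarrow> distinct (inorder t)"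
  by (induction t) auto

lemma Min_andre_tree: "andre_tree lt \<langle>l, x, r\<rangle> \<Longrightarrow> Min (set_tree \<langle>l, x, r\<rangle>) = x"
  by (rule Min_eqI) (auto simp: less_imp_le)

text \<open>The root is the minimum of the word and occurs in it once, so the word determines the
  root and the words of both subtrees.\<close>

lemma inorder_inject_andre_tree:
  assumes "andre_tree lt t" "andre_tree lt t'" "inorder t = inorder t'"
  shows "t = t'"
  using assms
proof (induction t arbitrary: t')
  case Leaf
  then show ?case by (metis inorder.simps(1) set_inorder set_empty eq_set_tree_empty)
next
  case (Node l x r)
  from Node.prems(3) obtain l' x' r' where t': "t' = \<langle>l', x', r'\<rangle>" by (cases t') auto
  have "set_tree t' = set_tree \<langle>l, x, r\<rangle>"
    using Node.prems(3) set_inorder by metis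
  then have "x = x'"
    using Min_andre_tree Node.prems(1,2) t' by metis
  moreover have "x \<notin> set (inorder l)" "x \<notin> set (inorder r)"
    using distinct_inorder_andre_tree[OF Node.prems(1)] by auto
  ultimately have "inorder l = inorder l' \<and> inorder r = inorder r'"
    using Node.prems(3) t' by (auto simp: append_Cons_eq_iff)
  with Node \<open>x = x'\<close> t' show ?case by auto
qed

section \<open>Andr\'e permutations as trees\<close>

text \<open>Brings the tree condition into the form used by the rule \<open>split\<close>. The empty
  union belongs to one-letter words, which have a rule of their own.\<close>

lemma Max_Un_in_iff_max_less:
  assumes "finite A" "finite B" "A \<inter> B = {}"
  shows "max_less A B \<longleftrightarrow> A \<union> B = {} \<or> Max (A \<union> B) \<in> B"
proof (cases "A = {} \<or> B = {}")
  case False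
  with assms have "Max (A \<union> B) = max (Max A) (Max B)" "Max A \<in> A" "Max B \<in> B"
    by (auto simp: Max_Un)
  moreover from this assms have "Max A \<noteq> Max B" by (metis disjoint_iff)
  ultimately show ?thesis
    using False assms unfolding max_less_def
    by (cases "Max A \<le> Max B") (auto simp: max_def disjoint_iff simp del: Max_less_iff Max_le_iff)
next
  case True
  with assms show ?thesis by (cases "B = {}") (auto simp: max_less_def)
qed

lemma Min_Un_in_iff_min_less:
  assumes "finite A" "finite B" "A \<inter> B = {}"
  shows "min_less A B \<longleftrightarrow> A \<union> B = {} \<or> Min (A \<union> B) \<in> B"
proof (cases "A = {} \<or> B = {}")
  case False
  with assms have "Min (A \<union> B) = min (Min A) (Min B)" "Min A \<in> A" "Min B \<in> B"
    by (auto simp: Min_Un)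
  with False assms show ?thesis
    unfolding min_less_def by (cases "Min A \<le> Min B")
      (auto simp: min_def disjoint_iff order_le_less simp del: Min_gr_iff Min_ge_iff)
next
  case True
  with assms show ?thesis by (cases "B = {}") (auto simp: min_less_def)
qed

lemma Min_split_less:
  assumes "distinct (v @ m # v')" "m = Min (set (v @ m # v'))"
  shows "\<forall>y \<in> set v \<union> set v'. m < y"
proof
  fix y assume y: "y \<in> set v \<union> set v'"
  then have "Min (set (v @ m # v')) \<le> y" by (intro Min_le) auto
  with assms y show "m < y" by (cases "m = y") auto
qed

lemma andreI_iff_tree: "andreI w \<longleftrightarrow> (\<exists>t. andre_tree max_less t \<and> inorder t = w)"
proof
  assume "andreI w"
  then show "\<exists>t. andre_tree max_less t \<and> inorder t = w"
  proof induction
    case empty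
    show ?case by (intro exI[of _ "\<langle>\<rangle>"]) simp
  next
    case (single x)
    show ?case by (intro exI[of _ "\<langle>\<langle>\<rangle>, x, \<langle>\<rangle>\<rangle>"]) (simp add: max_less_def)
  next
    case (split v m v')
    then obtain l r where lr: "andre_tree max_less l" "inorder l = v"
        "andre_tree max_less r" "inorder r = v'" by auto
    then have sets: "set_tree l = set v" "set_tree r = set v'" using set_inorder by metis+
    have "max_less (set v) (set v')"
      using split by (subst Max_Un_in_iff_max_less) auto
    with Min_split_less[of v m v'] split sets lr have "andre_tree max_less \<langle>l, m, r\<rangle>"
      by auto
    with lr show ?case by (intro exI[of _ "\<langle>l, m, r\<rangle>"]) simp
  qed
next
  have "andreI (inorder t)" if "andre_tree max_less t" for t
    using that
  proof (induction t)
    case Leaf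
    show ?case by (simp add: andreI.empty)
  next
    case (Node l x r)
    show ?case
    proof (cases "set_tree l \<union> set_tree r = {}")
      case True
      then show ?thesis by (auto simp: andreI.single)
    next
      case False
      then have "Max (set_tree l \<union> set_tree r) \<in> set_tree r"
        using Node.prems Max_Un_in_iff_max_less[of "set_tree l" "set_tree r"] by auto
      moreover have "x = Min (set (inorder l @ x # inorder r))"
        using Min_andre_tree[OF Node.prems] by simp
      moreover have "distinct (inorder l @ x # inorder r)"
        using distinct_inorder_andre_tree[OF Node.prems] by simp
      moreover have "inorder l @ inorder r \<noteq> []"
        using False by (metis append_is_Nil_conv set_inorder empty_set sup_bot.right_neutral)
      ultimately show ?thesis
        using Node by (auto intro!: andreI.split)
    qed
  qed
  then show "\<exists>t. andre_tree max_less t \<and> inorder t = w \<Longrightarrow> andreI w" by auto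
qed

lemma andreII_iff_tree: "andreII w \<longleftrightarrow> (\<exists>t. andre_tree min_less t \<and> inorder t = w)"
proof
  assume "andreII w"
  then show "\<exists>t. andre_tree min_less t \<and> inorder t = w"
  proof induction
    case empty
    show ?case by (intro exI[of _ "\<langle>\<rangle>"]) simp
  next
    case (single x)
    show ?case by (intro exI[of _ "\<langle>\<langle>\<rangle>, x, \<langle>\<rangle>\<rangle>"]) (simp add: min_less_def)
  next
    case (split v m v')
    then obtain l r where lr: "andre_tree min_less l" "inorder l = v"
        "andre_tree min_less r" "inorder r = v'" by auto
    then have sets: "set_tree l = set v" "set_tree r = set v'" using set_inorder by metis+
    have "min_less (set v) (set v')"
      using split by (subst Min_Un_in_iff_min_less) auto
    with Min_split_less[of v m v'] split sets lr have "andre_tree min_less \<langle>l, m, r\<rangle>"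
      by auto
    with lr show ?case by (intro exI[of _ "\<langle>l, m, r\<rangle>"]) simp
  qed
next
  have "andreII (inorder t)" if "andre_tree min_less t" for t
    using that
  proof (induction t)
    case Leaf
    show ?case by (simp add: andreII.empty)
  next
    case (Node l x r)
    show ?case
    proof (cases "set_tree l \<union> set_tree r = {}")
      case True
      then show ?thesis by (auto simp: andreII.single)
    next
      case False
      then have "Min (set_tree l \<union> set_tree r) \<in> set_tree r"
        using Node.prems Min_Un_in_iff_min_less[of "set_tree l" "set_tree r"] by auto
      moreover have "x = Min (set (inorder l @ x # inorder r))"
        using Min_andre_tree[OF Node.prems] by simp
      moreover have "distinct (inorder l @ x # inorder r)"
        using distinct_inorder_andre_tree[OF Node.prems] by simp
      moreover have "inorder l @ inorder r \<noteq> []"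
        using False by (metis append_is_Nil_conv set_inorder empty_set sup_bot.right_neutral)
      ultimately show ?thesis
        using Node by (auto intro!: andreII.split)
    qed
  qed
  then show "\<exists>t. andre_tree min_less t \<and> inorder t = w \<Longrightarrow> andreII w" by auto
qed

text \<open>Type I trees also stand for trees without an order of siblings, so both families of
  words are indexed by this one set.\<close>

definition max_trees :: "nat \<Rightarrow> nat tree set" where
  "max_trees n = {t. andre_tree max_less t \<and> set_tree t = {1..n}}"

lemma bij_betw_inorder_AndI: "bij_betw inorder (max_trees n) (AndI n)"
  unfolding bij_betw_def
proof
  show "inj_on inorder (max_trees n)"
    by (auto simp: inj_on_def max_trees_def intro: inorder_inject_andre_tree)
  show "inorder ` max_trees n = AndI n"
  proof
    show "inorder ` max_trees n \<subseteq> AndI n"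
    proof (rule image_subsetI)
      fix t assume "t \<in> max_trees n"
      then have t: "andre_tree max_less t" "set_tree t = {1..n}" by (auto simp: max_trees_def)
      then have "andreI (inorder t)" using andreI_iff_tree by blast
      with t show "inorder t \<in> AndI n"
        using distinct_inorder_andre_tree by (simp add: AndI_def permutations_of_set_def)
    qed
    show "AndI n \<subseteq> inorder ` max_trees n"
    proof
      fix w assume "w \<in> AndI n"
      then obtain t where "andre_tree max_less t" "inorder t = w" "set_tree t = {1..n}"
        unfolding AndI_def permutations_of_set_def andreI_iff_tree by auto
      then show "w \<in> inorder ` max_trees n" by (auto simp: max_trees_def)
    qed
  qed
qed

definition min_word :: "nat tree \<Rightarrow> nat list" where
  "min_word t = inorder (sort_tree min_less t)"

lemma bij_betw_min_word_AndII: "bij_betw min_word (max_trees n) (AndII n)"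
  unfolding bij_betw_def
proof
  note sorted = andre_tree_sort_tree[OF sibling_order_min_less]
  show "inj_on min_word (max_trees n)"
  proof (rule inj_onI)
    fix t t' assume tt: "t \<in> max_trees n" "t' \<in> max_trees n" "min_word t = min_word t'"
    then have "sort_tree min_less t = sort_tree min_less t'"
      unfolding max_trees_def min_word_def by (auto intro: inorder_inject_andre_tree sorted)
    with tt show "t = t'"
      using sort_tree_sort_tree[OF sibling_order_max_less] unfolding max_trees_def
      by (metis mem_Collect_eq)
  qed
  show "min_word ` max_trees n = AndII n"
  proof
    show "min_word ` max_trees n \<subseteq> AndII n"
    proof (rule image_subsetI)
      fix t assume "t \<in> max_trees n"
      then have t: "andre_tree min_less (sort_tree min_less t)" "set_tree t = {1..n}"
        using sorted by (auto simp: max_trees_def)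
      then have "andreII (min_word t)" unfolding min_word_def using andreII_iff_tree by blast
      with t show "min_word t \<in> AndII n"
        using distinct_inorder_andre_tree
        by (simp add: AndII_def permutations_of_set_def min_word_def)
    qed
    show "AndII n \<subseteq> min_word ` max_trees n"
    proof
      fix w assume "w \<in> AndII n"
      then obtain t where t: "andre_tree min_less t" "inorder t = w" "set_tree t = {1..n}"
        unfolding AndII_def permutations_of_set_def andreII_iff_tree by auto
      have "w = min_word (sort_tree max_less t)"
        using t sort_tree_sort_tree[OF sibling_order_min_less] by (simp add: min_word_def)
      moreover have "sort_tree max_less t \<in> max_trees n"
        using t andre_tree_sort_tree[OF sibling_order_max_less] by (simp add: max_trees_def)
      ultimately show "w \<in> min_word ` max_trees n" by blast
    qed
  qed
qed

section \<open>Rotating the spine\<close>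

text \<open>\<open>B\<close> is the side tree detached from \<open>x\<close>, and \<open>R\<close>
  is the spine below \<open>x\<close>. As a root is the minimum, the test asks whether
  \<open>B\<close> is empty or its root exceeds \<open>y\<close>; if so, \<open>C\<close> moves up
  to \<open>x\<close> and \<open>B\<close> goes on to \<open>y\<close>. In type I trees only an
  empty \<open>B\<close> reaches the end of the spine.\<close>

fun push :: "nat tree \<Rightarrow> nat \<Rightarrow> nat tree \<Rightarrow> nat tree" where
  "push B x \<langle>\<rangle> = \<langle>B, x, \<langle>\<rangle>\<rangle>"
| "push B x \<langle>C, y, R\<rangle> =
     (if min_less (set_tree B) (set_tree \<langle>C, y, R\<rangle>) then \<langle>C, x, push B y R\<rangle>
      else \<langle>B, x, \<langle>C, y, R\<rangle>\<rangle>)"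

text \<open>Recursion enters only the left subtree; the other side trees are shifted by
  \<open>push\<close> as they are.\<close>

fun rotate_spines :: "nat tree \<Rightarrow> nat tree" where
  "rotate_spines \<langle>\<rangle> = \<langle>\<rangle>"
| "rotate_spines \<langle>l, x, r\<rangle> = push (rotate_spines l) x r"

lemma set_push [simp]: "set_tree (push B x R) = insert x (set_tree B \<union> set_tree R)"
  by (induction B x R rule: push.induct) auto

lemma push_neq_Leaf [simp]: "push B x R \<noteq> \<langle>\<rangle>"
  by (cases R) auto

lemma value_push: "value (push B x R) = x"
  by (cases R) auto

lemma value_right_push: "value (right (push B x \<langle>C, y, R\<rangle>)) = y"
  by (simp add: value_push)

lemma set_rotate_spines [simp]: "set_tree (rotate_spines t) = set_tree t"
  by (induction t) auto

lemma rotate_spines_eq_Leaf_iff [simp]: "rotate_spines t = \<langle>\<rangle> \<longleftrightarrow> t = \<langle>\<rangle>"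
  by (cases t) auto

section \<open>Position of the maximum in a type I tree\<close>

lemma max_less_empty_right [simp]: "max_less A {} \<longleftrightarrow> A = {}"
  by (simp add: max_less_def)

lemma max_tree_LeafD: "andre_tree max_less \<langle>l, x, \<langle>\<rangle>\<rangle> \<Longrightarrow> l = \<langle>\<rangle>"
  by simp

lemma Max_max_tree:
  assumes "andre_tree max_less \<langle>l, x, r\<rangle>" "r \<noteq> \<langle>\<rangle>"
  shows "Max (set_tree \<langle>l, x, r\<rangle>) = Max (set_tree r)"
proof (rule Max_eqI)
  have r: "Max (set_tree r) \<in> set_tree r" using assms(2) by (intro Max_in) auto
  then show "Max (set_tree r) \<in> set_tree \<langle>l, x, r\<rangle>" by simp
  fix y assume y: "y \<in> set_tree \<langle>l, x, r\<rangle>"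
  then consider "y \<in> set_tree l" | "y = x" | "y \<in> set_tree r" by auto
  then show "y \<le> Max (set_tree r)"
  proof cases
    case 1
    then have "y \<le> Max (set_tree l)" by simp
    moreover have "Max (set_tree l) < Max (set_tree r)"
      using assms 1 by (auto simp: max_less_def)
    ultimately show ?thesis by simp
  next
    case 2
    then show ?thesis using assms(1) r by (auto intro: less_imp_le)
  qed simp
qed simp

lemma Max_max_tree_notin_left:
  assumes "andre_tree max_less \<langle>l, x, r\<rangle>"
  shows "Max (set_tree \<langle>l, x, r\<rangle>) \<notin> set_tree l"
proof (cases "r = \<langle>\<rangle>")
  case True
  then show ?thesis using assms by auto
next
  case False
  then have "Max (set_tree r) \<in> set_tree r" by (intro Max_in) auto
  then show ?thesis using Max_max_tree[OF assms False] assms by auto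
qed

lemma last_inorder_max_tree:
  assumes "andre_tree max_less t" "t \<noteq> \<langle>\<rangle>"
  shows "last (inorder t) = Max (set_tree t)"
  using assms
proof (induction t)
  case (Node l x r)
  show ?case
  proof (cases "r = \<langle>\<rangle>")
    case True
    then show ?thesis using Node.prems by auto
  next
    case False
    then have "inorder r \<noteq> []" by (cases r) auto
    then show ?thesis using Node False Max_max_tree[OF Node.prems(1) False] by simp
  qed
qed simp

section \<open>Pushing preserves type I trees and is injective\<close>

lemma min_less_if_all_greater:
  assumes "\<forall>c \<in> set_tree B. y < c" "Min S = y" "S \<noteq> {}"
  shows "min_less (set_tree B) S"
  using assms by (auto simp: min_less_def)

text \<open>Invariant of the descent. By the test, the labels of a nonempty \<open>B\<close> exceed
  \<open>y\<close>. Its maximum is below that of \<open>\<langle>C, y, R\<rangle>\<close>, which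
  lies in \<open>R\<close>: were \<open>R\<close> a leaf, that maximum would be \<open>y\<close>,
  which is too small.\<close>

lemma andre_tree_push_step:
  assumes "andre_tree max_less \<langle>B, x, \<langle>C, y, R\<rangle>\<rangle>"
    and "min_less (set_tree B) (set_tree \<langle>C, y, R\<rangle>)"
  shows "andre_tree max_less \<langle>B, y, R\<rangle>"
proof (cases "B = \<langle>\<rangle>")
  case True
  then show ?thesis using assms by (simp add: max_less_def)
next
  case False
  have R: "andre_tree max_less \<langle>C, y, R\<rangle>" using assms(1) by simp
  have y: "\<forall>b \<in> set_tree B. y < b"
    using assms(2) False unfolding Min_andre_tree[OF R] min_less_def by auto
  have Max: "Max (set_tree B) < Max (set_tree \<langle>C, y, R\<rangle>)"
    using assms(1) False by (simp add: max_less_def)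
  have "Max (set_tree B) \<in> set_tree B" using False by (intro Max_in) auto
  with y have "y < Max (set_tree B)" by blast
  with Max R have "R \<noteq> \<langle>\<rangle>" using max_tree_LeafD by force
  with Max have "max_less (set_tree B) (set_tree R)"
    using Max_max_tree[OF R] by (simp add: max_less_def)
  with assms(1) y show ?thesis by auto
qed

lemma andre_tree_push:
  "andre_tree max_less \<langle>B, x, R\<rangle> \<Longrightarrow> andre_tree max_less (push B x R)"
proof (induction B x R rule: push.induct)
  case (2 B x C y R)
  show ?case
  proof (cases "min_less (set_tree B) (set_tree \<langle>C, y, R\<rangle>)")
    case True
    \<comment> \<open>Moved up to \<open>x\<close>, the tree \<open>C\<close> still has the smaller
      maximum, since \<open>R\<close> lies in the new right subtree.\<close>
    have "max_less (set_tree C) (insert y (set_tree B \<union> set_tree R))"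
    proof (cases "C = \<langle>\<rangle>")
      case False
      then have "Max (set_tree C) < Max (set_tree R)" "R \<noteq> \<langle>\<rangle>"
        using "2.prems" by (auto simp: max_less_def)
      moreover from this have "Max (set_tree R) \<le> Max (insert y (set_tree B \<union> set_tree R))"
        by (intro Max_mono) auto
      ultimately show ?thesis unfolding max_less_def by (metis insert_not_empty order_less_le_trans)
    qed (simp add: max_less_def)
    with True "2.IH"[OF True andre_tree_push_step[OF "2.prems" True]] "2.prems"
    show ?thesis by auto
  next
    case False
    then show ?thesis using "2.prems" by simp
  qed
qed simp

lemma push_inject:
  assumes "andre_tree max_less \<langle>B, x, R\<rangle>" "andre_tree max_less \<langle>B', x', R'\<rangle>"
    and "push B x R = push B' x' R'"
  shows "B = B' \<and> x = x' \<and> R = R'"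
  using assms
proof (induction R arbitrary: B x B' x' R')
  case Leaf
  \<comment> \<open>Pushing onto a leaf leaves a leaf as right child, and pushing onto a nonempty
    spine never does.\<close>
  then have "R' = \<langle>\<rangle>"
    using push_neq_Leaf by (cases R') (auto split: if_splits simp del: andre_tree.simps dest: sym)
  with Leaf show ?case by simp
next
  case (Node C y R)
  have "R' \<noteq> \<langle>\<rangle>" using Node.prems(3) by (auto split: if_splits)
  then obtain C' y' S where R': "R' = \<langle>C', y', S\<rangle>" by (cases R') auto
  have yy: "y = y'"
    using Node.prems(3) value_right_push unfolding R' by metis
  have trees: "andre_tree max_less \<langle>C, y, R\<rangle>" "andre_tree max_less \<langle>C', y, S\<rangle>"
    using Node.prems(1,2) R' yy by auto
  \<comment> \<open>In the push case the new left child lies entirely above \<open>y\<close>, in the other case it does not,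
      so the two cases can be told apart from the result.\<close>
  have "min_less (set_tree C) (set_tree \<langle>C', y, S\<rangle>)" "min_less (set_tree C') (set_tree \<langle>C, y, R\<rangle>)"
    using trees by (auto intro!: min_less_if_all_greater Min_andre_tree simp del: tree.set)
  then show ?case
    using Node.IH[of B y B' y S] Node.prems R' yy andre_tree_push_step[of B x C y R]
      andre_tree_push_step[of B' x' C' y S]
    by (auto split: if_splits simp del: andre_tree.simps tree.set)
qed

lemma andre_tree_rotate_spines:
  "andre_tree max_less t \<Longrightarrow> andre_tree max_less (rotate_spines t)"
  by (induction t) (auto intro: andre_tree_push)

lemma rotate_spines_inject:
  assumes "andre_tree max_less t" "andre_tree max_less t'" "rotate_spines t = rotate_spines t'"
  shows "t = t'"
  using assms
proof (induction t arbitrary: t')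
  case Leaf
  then show ?case by (metis rotate_spines.simps(1) rotate_spines_eq_Leaf_iff)
next
  case (Node l x r)
  then obtain l' x' r' where t': "t' = \<langle>l', x', r'\<rangle>" by (cases t') auto
  have "rotate_spines l = rotate_spines l' \<and> x = x' \<and> r = r'"
    using Node.prems t' andre_tree_rotate_spines by (intro push_inject) auto
  with Node t' show ?case by auto
qed

text \<open>An injective self-map of a finite set is onto, so no inverse is constructed. Finiteness
  comes from \<open>AndI n\<close> through \<open>inorder\<close>.\<close>

lemma bij_betw_rotate_spines: "bij_betw rotate_spines (max_trees n) (max_trees n)"
proof -
  have "finite (max_trees n)"
    using bij_betw_finite[OF bij_betw_inorder_AndI] by (simp add: AndI_def)
  moreover have "inj_on rotate_spines (max_trees n)"
    by (auto simp: inj_on_def max_trees_def intro: rotate_spines_inject)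
  moreover have "rotate_spines ` max_trees n \<subseteq> max_trees n"
    by (rule image_subsetI) (simp add: max_trees_def andre_tree_rotate_spines)
  ultimately show ?thesis
    by (simp add: bij_betw_def endo_inj_surj)
qed

section \<open>Last letter and pit\<close>

lemma set_min_word [simp]: "set (min_word t) = set_tree t"
  by (simp add: min_word_def)

lemma min_word_eq_Nil_iff [simp]: "min_word t = [] \<longleftrightarrow> t = \<langle>\<rangle>"
  by (metis eq_set_tree_empty set_empty set_min_word)

lemma min_word_Node:
  "min_word \<langle>l, x, r\<rangle> =
    (if min_less (set_tree l) (set_tree r) then min_word l @ x # min_word r
     else min_word r @ x # min_word l)"
  by (simp add: min_word_def)

lemma distinct_min_word: "andre_tree lt t \<Longrightarrow> distinct (min_word t)"
  unfolding min_word_def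
  by (rule distinct_inorder_andre_tree[OF andre_tree_sort_tree[OF sibling_order_min_less]])

text \<open>On trees the recursion of \<open>pit\<close> is the walk to the child with the smaller
  root, which comes last in type II order; it stops once the current word ends with its
  maximum.\<close>

lemma pit_min_word_Node:
  assumes "andre_tree lt \<langle>l, x, r\<rangle>"
    and "last (min_word \<langle>l, x, r\<rangle>) \<noteq> Max (set_tree \<langle>l, x, r\<rangle>)"
  shows "pit (min_word \<langle>l, x, r\<rangle>) =
    pit (min_word (if min_less (set_tree l) (set_tree r) then r else l))"
proof (rule pit_split)
  let ?w1 = "min_word (if min_less (set_tree l) (set_tree r) then l else r)"
  show "min_word \<langle>l, x, r\<rangle> = ?w1 @ Min (set (min_word \<langle>l, x, r\<rangle>)) #
      min_word (if min_less (set_tree l) (set_tree r) then r else l)"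
    unfolding set_min_word Min_andre_tree[OF assms(1)] by (simp add: min_word_Node)
  show "distinct (min_word \<langle>l, x, r\<rangle>)" using assms(1) by (rule distinct_min_word)
  show "last (min_word \<langle>l, x, r\<rangle>) \<noteq> Max (set (min_word \<langle>l, x, r\<rangle>))"
    using assms(2) unfolding set_min_word .
qed

text \<open>Where \<open>B\<close> has been pushed past \<open>x\<close>, the walk stays on the
  spine: all of \<open>C\<close> lies above \<open>y\<close>, the root of the right subtree.\<close>

lemma min_less_push:
  assumes "andre_tree max_less \<langle>C, y, R\<rangle>" "andre_tree max_less \<langle>B, y, R\<rangle>"
  shows "min_less (set_tree C) (set_tree (push B y R))"
  using assms Min_andre_tree[OF assms(2)] by (intro min_less_if_all_greater) auto

text \<open>The last letter is the end of the walk to the smaller child. The walk follows the spine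
  to the place of a nonempty \<open>B\<close> and turns into \<open>B\<close> there, as the failed
  test means that \<open>B\<close> has the smaller root. With \<open>B\<close> empty it runs to the
  end of the spine, the maximum.\<close>

lemma last_min_word_push:
  assumes "andre_tree max_less \<langle>B, x, R\<rangle>"
  shows "last (min_word (push B x R)) =
    (if B = \<langle>\<rangle> then Max (set_tree \<langle>B, x, R\<rangle>) else last (min_word B))"
  using assms
proof (induction B x R rule: push.induct)
  case (1 B x)
  then have "B = \<langle>\<rangle>" by (rule max_tree_LeafD)
  then show ?case by (simp add: min_word_def min_less_def)
next
  case (2 B x C y R)
  show ?case
  proof (cases "min_less (set_tree B) (set_tree \<langle>C, y, R\<rangle>)")
    case True
    note step = andre_tree_push_step[OF "2.prems" True]
    have R: "andre_tree max_less \<langle>C, y, R\<rangle>" using "2.prems" by simp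
    \<comment> \<open>Replacing \<open>C\<close> by \<open>B\<close> keeps the maximum, so the
      induction hypothesis speaks of the maximum of the whole tree.\<close>
    have "Max (set_tree \<langle>B, y, R\<rangle>) = Max (set_tree \<langle>C, y, R\<rangle>)"
    proof (cases "R = \<langle>\<rangle>")
      case True
      then show ?thesis using step R max_tree_LeafD by blast
    next
      case False
      then show ?thesis using Max_max_tree step R by metis
    qed
    also have "\<dots> = Max (set_tree \<langle>B, x, \<langle>C, y, R\<rangle>\<rangle>)"
      using Max_max_tree[OF "2.prems"] by simp
    finally have Max: "Max (set_tree \<langle>B, y, R\<rangle>) = Max (set_tree \<langle>B, x, \<langle>C, y, R\<rangle>\<rangle>)" .
    have "min_word (push B x \<langle>C, y, R\<rangle>) = min_word C @ x # min_word (push B y R)"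
      using True min_less_push[OF R step] by (simp add: min_word_Node del: tree.set set_push)
    then have "last (min_word (push B x \<langle>C, y, R\<rangle>)) = last (min_word (push B y R))"
      by simp
    then show ?thesis
      using "2.IH"[OF True step] Max by presburger
  next
    case False
    then have "B \<noteq> \<langle>\<rangle>" by (auto simp: min_less_def)
    with False show ?thesis by (simp add: min_word_Node)
  qed
qed

text \<open>If \<open>B\<close> is empty, the word ends with its maximum and \<open>pit\<close>
  stops at the root. Otherwise the last letter belongs to \<open>B\<close>, so it is not the maximum
  at any spine vertex passed, and the recursion runs down the spine and into
  \<open>B\<close>.\<close>

lemma pit_min_word_push:
  assumes "andre_tree max_less \<langle>B, x, R\<rangle>"
  shows "pit (min_word (push B x R)) = (if B = \<langle>\<rangle> then x else pit (min_word B))"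
proof (cases "B = \<langle>\<rangle>")
  case True
  then have "pit (min_word (push B x R)) = Min (set (min_word (push B x R)))"
    using last_min_word_push[OF assms] by (intro pit_max_last) auto
  with True show ?thesis using Min_andre_tree[OF assms] by simp
next
  case False
  with assms have "pit (min_word (push B x R)) = pit (min_word B)"
  proof (induction B x R rule: push.induct)
    case (2 B x C y R)
    let ?t = "\<langle>C, y, R\<rangle>"
    have "last (min_word B) \<in> set_tree B"
      using "2.prems"(2) last_in_set set_min_word min_word_eq_Nil_iff by metis
    then have "last (min_word B) \<noteq> Max (set_tree \<langle>B, x, ?t\<rangle>)"
      using Max_max_tree_notin_left[OF "2.prems"(1)] by metis
    moreover have "set_tree (push B x ?t) = set_tree \<langle>B, x, ?t\<rangle>" by auto
    ultimately have last: "last (min_word (push B x ?t)) \<noteq> Max (set_tree (push B x ?t))"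
      using last_min_word_push[OF "2.prems"(1)] "2.prems"(2) by argo
    note push = andre_tree_push[OF "2.prems"(1)]
    show ?case
    proof (cases "min_less (set_tree B) (set_tree ?t)")
      case True
      note step = andre_tree_push_step[OF "2.prems"(1) True]
      have "min_less (set_tree C) (set_tree (push B y R))"
        using "2.prems"(1) step by (intro min_less_push) simp_all
      moreover have eq: "push B x ?t = \<langle>C, x, push B y R\<rangle>" using True by simp
      ultimately have "pit (min_word (push B x ?t)) = pit (min_word (push B y R))"
        unfolding eq using pit_min_word_Node[OF push[unfolded eq] last[unfolded eq]] by presburger
      with "2.IH"[OF True step "2.prems"(2)] show ?thesis by simp
    next
      case False
      then have eq: "push B x ?t = \<langle>B, x, ?t\<rangle>" by simp
      show ?thesis
        unfolding eq using pit_min_word_Node[OF push[unfolded eq] last[unfolded eq]] False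
        by presburger
    qed
  qed simp
  with False show ?thesis by simp
qed

section \<open>The parent of the maximum\<close>

text \<open>The maximum of an increasing tree has no children, so its parent is the vertex with a
  subtree whose label set is \<open>{M}\<close>. The value 0 is a default for \<open>M\<close> at
  the root or absent.\<close>

fun parent_of :: "nat \<Rightarrow> nat tree \<Rightarrow> nat" where
  "parent_of M \<langle>\<rangle> = 0"
| "parent_of M \<langle>l, x, r\<rangle> =
     (if set_tree l = {M} \<or> set_tree r = {M} then x
      else if M \<in> set_tree l then parent_of M l
      else if M \<in> set_tree r then parent_of M r else 0)"

lemma parent_of_right:
  "M \<notin> set_tree l \<Longrightarrow> M \<in> set_tree r \<Longrightarrow>
   parent_of M \<langle>l, x, r\<rangle> = (if set_tree r = {M} then x else parent_of M r)"
  by auto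

lemma parent_of_left:
  "M \<in> set_tree l \<Longrightarrow> M \<notin> set_tree r \<Longrightarrow>
   parent_of M \<langle>l, x, r\<rangle> = (if set_tree l = {M} then x else parent_of M l)"
  by auto

lemma parent_of_sort_tree:
  "andre_tree lt t \<Longrightarrow> parent_of M (sort_tree lt' t) = parent_of M t"
proof (induction t)
  case (Node l x r)
  then have IH: "parent_of M (sort_tree lt' l) = parent_of M l"
    "parent_of M (sort_tree lt' r) = parent_of M r"
    and disj: "set_tree l \<inter> set_tree r = {}" by simp_all
  consider "M \<in> set_tree l" "M \<notin> set_tree r" | "M \<notin> set_tree l" "M \<in> set_tree r"
    | "M \<notin> set_tree l" "M \<notin> set_tree r"
    using disj by blast
  then show ?case
  proof cases
    case 3
    then have "set_tree l \<noteq> {M}" "set_tree r \<noteq> {M}" by auto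
    with 3 show ?thesis by simp
  qed (simp_all add: IH parent_of_left parent_of_right del: parent_of.simps)
qed simp

text \<open>A push moves side trees and keeps the spine labels. The maximum ends the spine, so its
  parent is the spine label before it and stays the same.\<close>

lemma parent_of_push:
  assumes "andre_tree max_less \<langle>B, x, R\<rangle>" "R \<noteq> \<langle>\<rangle>" "M = Max (set_tree \<langle>B, x, R\<rangle>)"
  shows "parent_of M (push B x R) = parent_of M \<langle>B, x, R\<rangle>"
  using assms
proof (induction B x R rule: push.induct)
  case (2 B x C y R)
  let ?t = "\<langle>C, y, R\<rangle>"
  have t: "andre_tree max_less ?t" using "2.prems"(1) by simp
  have Mt: "M = Max (set_tree ?t)" using Max_max_tree "2.prems" by metis
  have MB: "M \<notin> set_tree B" using Max_max_tree_notin_left "2.prems"(1,3) by metis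
  have MC: "M \<notin> set_tree C" using Max_max_tree_notin_left t Mt by metis
  show ?case
  proof (cases "min_less (set_tree B) (set_tree ?t)")
    case True
    note step = andre_tree_push_step[OF "2.prems"(1) True]
    show ?thesis
    proof (cases "R = \<langle>\<rangle>")
      case R: True
      then have "B = \<langle>\<rangle>" "C = \<langle>\<rangle>" using step t by auto
      with R True Mt show ?thesis by simp
    next
      case False
      have "Max (set_tree R) \<in> set_tree R" using False by (intro Max_in) auto
      then have MR: "M \<in> set_tree R" using Mt Max_max_tree[OF t False] by simp
      \<comment> \<open>\<open>M\<close> lies strictly below \<open>y\<close>, so a subtree rooted
        at \<open>y\<close> never has label set \<open>{M}\<close> and the search goes past
        \<open>x\<close>.\<close>
      then have "y \<noteq> M" using t by auto
      have "M = Max (set_tree \<langle>B, y, R\<rangle>)"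
        using Mt Max_max_tree[OF t False] Max_max_tree[OF step False] by simp
      then have IH: "parent_of M (push B y R) = parent_of M \<langle>B, y, R\<rangle>"
        using "2.IH"[OF True step False] by simp
      have "parent_of M (push B x ?t) = parent_of M \<langle>C, x, push B y R\<rangle>"
        using True by simp
      also have "\<dots> = parent_of M \<langle>B, y, R\<rangle>"
        using IH MC MR \<open>y \<noteq> M\<close> by (subst parent_of_right) auto
      also have "\<dots> = parent_of M \<langle>C, y, R\<rangle>"
        using MB MC MR by (simp add: parent_of_right del: parent_of.simps)
      also have "\<dots> = parent_of M \<langle>B, x, \<langle>C, y, R\<rangle>\<rangle>"
        using MB MR \<open>y \<noteq> M\<close> by (subst parent_of_right[of M B]) auto
      finally show ?thesis .
    qed
  qed simp
qed simp

section \<open>Reading the parent of the maximum off a word\<close>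

lemma singleton_andre_tree:
  assumes "andre_tree lt t" "set_tree t = {M}"
  shows "t = \<langle>\<langle>\<rangle>, M, \<langle>\<rangle>\<rangle>"
proof (cases t)
  case (Node l x r)
  then have "x = M" "set_tree l \<subseteq> {M}" "set_tree r \<subseteq> {M}"
    using assms(2) by auto
  moreover have "x \<notin> set_tree l" "x \<notin> set_tree r"
    using assms(1) Node by auto
  ultimately have "set_tree l = {}" "set_tree r = {}" by blast+
  with \<open>x = M\<close> Node show ?thesis by simp
qed (use assms in simp)

text \<open>\<open>last (0 # u)\<close> and \<open>hd (v @ [0])\<close> build in the convention that
  the letters beyond both ends are 0. Positions start at 1, so \<open>M\<close> stands at
  \<open>Suc (length u)\<close>.\<close>

lemma letter_neighbours:
  assumes "w = u @ M # v"
  shows "letter w (length u) = last (0 # u)" "letter w (Suc (length u)) = M"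
    "letter w (Suc (Suc (length u))) = hd (v @ [0])"
proof -
  show "letter w (length u) = last (0 # u)"
    using assms by (cases u rule: rev_cases) (auto simp: letter_def nth_append)
  show "letter w (Suc (length u)) = M"
    using assms by (simp add: letter_def)
  show "letter w (Suc (Suc (length u))) = hd (v @ [0])"
    using assms by (cases v) (auto simp: letter_def nth_append)
qed

lemma grn_eq_max_neighbours:
  assumes "w = u @ M # v" "distinct w" "M = Max (set w)"
  shows "grn w = max (last (0 # u)) (hd (v @ [0]))"
proof -
  have len: "length u < length w" and nth: "w ! length u = M"
    using assms(1) by simp_all
  have "(THE i. i \<in> {1..length w} \<and> letter w i = Max (set w)) = Suc (length u)"
    unfolding assms(3)[symmetric]
  proof (rule the_equality)
    show "Suc (length u) \<in> {1..length w} \<and> letter w (Suc (length u)) = M"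
      using letter_neighbours(2)[OF assms(1)] len by simp
    fix i assume i: "i \<in> {1..length w} \<and> letter w i = M"
    then have "w ! (i - 1) = w ! length u"
      using nth by (auto simp: letter_def)
    then have "i - 1 = length u"
      using i len assms(2) nth_eq_iff_index_eq[of w "i - 1" "length u"] by auto
    with i show "i = Suc (length u)" by auto
  qed
  then show ?thesis
    using letter_neighbours[OF assms(1)] by (simp add: grn_def)
qed

text \<open>The maximum has no children, so its neighbours in the word are ancestors; labels grow
  downwards, so the larger neighbour is the parent. Membership of the parent is carried along so
  that the induction can compare it with the root.\<close>

lemma max_neighbours_eq_parent_of:
  assumes "andre_tree lt t" "M = Max (set_tree t)" "set_tree t \<noteq> {M}" "inorder t = u @ M # v"
  shows "max (last (0 # u)) (hd (v @ [0])) = parent_of M t \<and> parent_of M t \<in> set_tree t"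
  using assms
proof (induction t arbitrary: u v)
  case (Node l x r)
  have less: "x < y" if "y \<in> set_tree l \<union> set_tree r" for y
    using Node.prems(1) that by simp
  have le: "y \<le> M" if "y \<in> set_tree \<langle>l, x, r\<rangle>" for y
    using Node.prems(2) that by (metis Max_ge finite_set_tree)
  have "M \<noteq> x"
  proof
    assume "M = x"
    then have "set_tree l = {}" "set_tree r = {}" using less le by fastforce+
    with \<open>M = x\<close> Node.prems(3) show False by simp
  qed
  moreover have "M \<in> set_tree \<langle>l, x, r\<rangle>"
    using Node.prems(4) by (metis in_set_conv_decomp set_inorder)
  ultimately consider "M \<in> set_tree l" | "M \<in> set_tree r" by auto
  moreover have disj: "set_tree l \<inter> set_tree r = {}" using Node.prems(1) by simp
  moreover have dist: "distinct (inorder l @ x # inorder r)"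
    using distinct_inorder_andre_tree[OF Node.prems(1)] by simp
  ultimately show ?case
  proof cases
    case 1
    then obtain a b where l: "inorder l = a @ M # b"
      by (metis set_inorder split_list)
    have "u @ M # v = a @ M # (b @ x # inorder r)" "distinct (u @ M # v)"
      using Node.prems(4) dist l by auto
    moreover from this(2) have "M \<notin> set u" "M \<notin> set v" by simp_all
    ultimately have uv: "u = a" "v = b @ x # inorder r"
      using append_Cons_eq_iff[of M u v] by blast+
    show ?thesis
    proof (cases "set_tree l = {M}")
      case True
      then have "a = []" "b = []"
        using singleton_andre_tree[of lt l M] Node.prems(1) l by (auto simp: Cons_eq_append_conv)
      with uv True show ?thesis by simp
    next
      case False
      have "M = Max (set_tree l)" using 1 le by (intro Max_eqI[symmetric]) auto
      then have IH: "max (last (0 # a)) (hd (b @ [0])) = parent_of M l" "parent_of M l \<in> set_tree l"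
        using Node.IH(1)[OF _ _ False l] Node.prems(1) by auto
      \<comment> \<open>At most, \<open>x\<close> replaces a missing neighbour 0; being below the
        parent, it does not change the larger neighbour.\<close>
      have "x < parent_of M l" using IH(2) less by simp
      moreover have "parent_of M \<langle>l, x, r\<rangle> = parent_of M l"
        using 1 False disj by auto
      ultimately show ?thesis using IH uv by (cases b) auto
    qed
  next
    case 2
    then obtain a b where r: "inorder r = a @ M # b"
      by (metis set_inorder split_list)
    have "u @ M # v = (inorder l @ x # a) @ M # b" "distinct (u @ M # v)"
      using Node.prems(4) dist r by auto
    moreover from this(2) have "M \<notin> set u" "M \<notin> set v" by simp_all
    ultimately have uv: "u = inorder l @ x # a" "v = b"
      using append_Cons_eq_iff[of M u v] by blast+
    show ?thesis
    proof (cases "set_tree r = {M}")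
      case True
      then have "a = []" "b = []"
        using singleton_andre_tree[of lt r M] Node.prems(1) r by (auto simp: Cons_eq_append_conv)
      with uv True show ?thesis by simp
    next
      case False
      have "M = Max (set_tree r)" using 2 le by (intro Max_eqI[symmetric]) auto
      then have IH: "max (last (0 # a)) (hd (b @ [0])) = parent_of M r" "parent_of M r \<in> set_tree r"
        using Node.IH(2)[OF _ _ False r] Node.prems(1) by auto
      have "x < parent_of M r" using IH(2) less by simp
      moreover have "parent_of M \<langle>l, x, r\<rangle> = parent_of M r"
        using 2 False disj by (subst parent_of_right) auto
      ultimately show ?thesis using IH uv by (cases a) auto
    qed
  qed
qed simp

lemma grn_inorder:
  assumes "andre_tree lt t" "M = Max (set_tree t)" "M \<in> set_tree t" "set_tree t \<noteq> {M}"
  shows "grn (inorder t) = parent_of M t"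
proof -
  obtain u v where uv: "inorder t = u @ M # v"
    using assms(3) by (metis set_inorder split_list)
  moreover have "distinct (inorder t)" using assms(1) by (rule distinct_inorder_andre_tree)
  moreover have "M = Max (set (inorder t))" using assms(2) by simp
  ultimately have "grn (inorder t) = max (last (0 # u)) (hd (v @ [0]))"
    by (rule grn_eq_max_neighbours)
  with uv show ?thesis using max_neighbours_eq_parent_of assms by metis
qed

text \<open>The maximum is the last letter, so its right neighbour is the 0 beyond the end and its
  left neighbour is the letter before the last.\<close>

lemma NL_stat_eq_grn:
  assumes "distinct w" "w \<noteq> []" "last w = Max (set w)"
  shows "NL_stat w = grn w"
proof -
  have w: "w = butlast w @ Max (set w) # []"
    using assms(2,3) by (metis append_butlast_last_id)
  have "grn w = last (0 # butlast w)"
    using grn_eq_max_neighbours[OF w assms(1)] by simp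
  also have "\<dots> = NL_stat w"
    using letter_neighbours(1)[OF w] by (simp add: NL_stat_def)
  finally show ?thesis by simp
qed

text \<open>Each side is the parent of the maximum: type I words end with their maximum, and sorting
  and rotating keep that parent.\<close>

lemma grn_min_word_rotate_spines:
  assumes "andre_tree max_less t" "M = Max (set_tree t)" "M \<in> set_tree t" "set_tree t \<noteq> {M}"
  shows "grn (min_word (rotate_spines t)) = NL_stat (inorder t)"
proof -
  note rot = andre_tree_rotate_spines[OF assms(1)]
  have "t \<noteq> \<langle>\<rangle>" using assms(3) by auto
  then obtain l x r where t: "t = \<langle>l, x, r\<rangle>" by (cases t) auto
  have "r \<noteq> \<langle>\<rangle>" using assms t by auto
  have l: "andre_tree max_less \<langle>rotate_spines l, x, r\<rangle>"
    using assms(1) t andre_tree_rotate_spines by auto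
  have "M \<notin> set_tree l" using assms(1,2) t Max_max_tree_notin_left by metis
  have "grn (min_word (rotate_spines t)) = parent_of M (sort_tree min_less (rotate_spines t))"
    unfolding min_word_def
    using assms andre_tree_sort_tree[OF sibling_order_min_less rot] by (intro grn_inorder) auto
  also have "\<dots> = parent_of M (rotate_spines t)"
    by (rule parent_of_sort_tree[OF rot])
  also have "\<dots> = parent_of M \<langle>rotate_spines l, x, r\<rangle>"
    using parent_of_push[OF l \<open>r \<noteq> \<langle>\<rangle>\<close>] assms(2) t by simp
  \<comment> \<open>\<open>M\<close> lies outside \<open>l\<close>, so the search never enters the
    rotated left subtree.\<close>
  also have "\<dots> = parent_of M t"
    using \<open>M \<notin> set_tree l\<close> t by simp
  also have "\<dots> = grn (inorder t)"
    using grn_inorder assms by metis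
  also have "\<dots> = NL_stat (inorder t)"
    using distinct_inorder_andre_tree[OF assms(1)] last_inorder_max_tree[OF assms(1) \<open>t \<noteq> \<langle>\<rangle>\<close>]
    by (intro NL_stat_eq_grn[symmetric]) (use t in auto)
  finally show ?thesis .
qed

section \<open>First letter and spike\<close>

lemma spi_eq_letter:
  assumes "w \<noteq> []" "0 \<notin> set w" "is_spike_pos w i"
  shows "spi w = letter w i"
  using the1_equality[OF ex1_spike_pos[OF assms(1,2)] assms(3)] by (simp add: spi_def)

text \<open>No letter falls below the first, so the first drop is to the 0 beyond the last
  letter.\<close>

lemma spi_Cons_greater:
  assumes "0 < x" "\<forall>y \<in> set ys. x < y"
  shows "spi (x # ys) = last (x # ys)"
proof -
  have "is_spike_pos (x # ys) (length (x # ys))"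
    using assms by (auto simp: is_spike_pos_def letter_def nth_Cons' less_imp_le)
  moreover have "0 \<notin> set (x # ys)" using assms by auto
  ultimately have "spi (x # ys) = letter (x # ys) (length (x # ys))"
    by (intro spi_eq_letter) auto
  then show ?thesis by (simp add: letter_def last_conv_nth)
qed

lemma spi_append_less:
  assumes "v \<noteq> []" "\<forall>y \<in> set v. x < y" "0 \<notin> set (v @ x # v')"
  shows "spi (v @ x # v') = spi v"
proof -
  obtain i where i: "is_spike_pos v i"
    using ex1_spike_pos[of v] assms by auto
  have same: "letter (v @ x # v') j = letter v j" if "j \<in> {1..length v}" for j
    using that by (auto simp: letter_def nth_append)
  have "letter (v @ x # v') (i + 1) < letter v 1"
  proof (cases "i = length v")
    \<comment> \<open>Here \<open>x\<close> takes over from the 0 beyond the end of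
      \<open>v\<close>; it too is below the first letter.\<close>
    case True
    then have "letter (v @ x # v') (i + 1) = x" by (simp add: letter_def)
    moreover have "letter v 1 \<in> set v" using assms(1) by (cases v) (auto simp: letter_def)
    ultimately show ?thesis using assms(2) by simp
  next
    case False
    then show ?thesis using i same[of "i + 1"] by (simp add: is_spike_pos_def)
  qed
  then have "is_spike_pos (v @ x # v') i"
    using i same by (auto simp: is_spike_pos_def)
  then have "spi (v @ x # v') = letter (v @ x # v') i"
    using assms(3) by (intro spi_eq_letter) auto
  also have "\<dots> = letter v i"
    using same i by (simp add: is_spike_pos_def)
  also have "\<dots> = spi v"
    using i assms by (intro spi_eq_letter[symmetric]) auto
  finally show ?thesis .
qed

text \<open>Both pairs follow the same recursion: root and maximum if the left subtree is empty, and
  otherwise the values of the left subtree.\<close>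

lemma F_spi_inorder:
  assumes "andre_tree max_less t" "t \<noteq> \<langle>\<rangle>" "0 \<notin> set_tree t"
  shows "F_stat (inorder t) = pit (min_word (rotate_spines t)) \<and>
    spi (inorder t) = last (min_word (rotate_spines t))"
  using assms
proof (induction t)
  case (Node l x r)
  have l: "andre_tree max_less \<langle>rotate_spines l, x, r\<rangle>"
    using Node.prems(1) andre_tree_rotate_spines by auto
  show ?case
  proof (cases "l = \<langle>\<rangle>")
    case True
    have "spi (inorder \<langle>l, x, r\<rangle>) = last (inorder \<langle>l, x, r\<rangle>)"
      using Node.prems True by (simp add: spi_Cons_greater)
    also have "\<dots> = Max (set_tree \<langle>l, x, r\<rangle>)"
      using Node.prems(1) by (rule last_inorder_max_tree) simp
    finally show ?thesis
      using True last_min_word_push[OF l] pit_min_word_push[OF l]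
      by (simp add: F_stat_def letter_def)
  next
    case False
    then have "inorder l \<noteq> []" by (cases l) auto
    moreover from this have "spi (inorder \<langle>l, x, r\<rangle>) = spi (inorder l)"
      using Node.prems spi_append_less[of "inorder l" x "inorder r"] by auto
    moreover have "F_stat (inorder \<langle>l, x, r\<rangle>) = F_stat (inorder l)"
      using \<open>inorder l \<noteq> []\<close> by (simp add: F_stat_def letter_def nth_append Suc_le_eq)
    ultimately show ?thesis
      using False Node last_min_word_push[OF l] pit_min_word_push[OF l] by simp
  qed
qed simp

section \<open>Transfer of the three statistics and the count\<close>

lemma statistics_rotate_spines:
  assumes "n \<ge> 2" "t \<in> max_trees n"
  shows "F_stat (inorder t) = pit (min_word (rotate_spines t))"
    and "spi (inorder t) = L_stat (min_word (rotate_spines t))"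
    and "NL_stat (inorder t) = grn (min_word (rotate_spines t))"
proof -
  have t: "andre_tree max_less t" "set_tree t = {1..n}"
    using assms(2) by (auto simp: max_trees_def)
  then have "t \<noteq> \<langle>\<rangle>" "0 \<notin> set_tree t" using assms(1) by auto
  note F_spi = F_spi_inorder[OF t(1) this]
  then show "F_stat (inorder t) = pit (min_word (rotate_spines t))" by simp
  have "L_stat w = last w" if "w \<noteq> []" for w
    using that by (simp add: L_stat_def letter_def last_conv_nth Suc_le_eq)
  with F_spi \<open>t \<noteq> \<langle>\<rangle>\<close> show "spi (inorder t) = L_stat (min_word (rotate_spines t))" by simp
  have "Max (set_tree t) = n"
    unfolding t(2) using assms(1) by (intro Max_eqI) auto
  moreover have "set_tree t \<noteq> {n}"
  proof
    assume "set_tree t = {n}"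
    then have "1 \<in> {n}" using t(2) assms(1) by auto
    with assms(1) show False by simp
  qed
  ultimately show "NL_stat (inorder t) = grn (min_word (rotate_spines t))"
    using grn_min_word_rotate_spines[OF t(1)] t(2) assms(1) by simp
qed

lemma card_Collect_bij_betw:
  assumes "bij_betw f A B"
  shows "card {y \<in> B. P y} = card {x \<in> A. P (f x)}"
proof -
  have "bij_betw f {x \<in> A. P (f x)} {y \<in> B. P y}"
    using assms by (auto simp: bij_betw_def inj_on_def)
  then show ?thesis by (metis bij_betw_same_card)
qed

theorem theorem3p1:
  fixes n :: nat and p q r :: int
  assumes "n \<ge> 2"
  shows "card {w \<in> AndI n. (int (F_stat w), int (spi w), int (NL_stat w)) = (p, q, r)}
       = card {w \<in> AndII n. (int (pit w), int (L_stat w), int (grn w)) = (p, q, r)}"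
proof -
  let ?P = "\<lambda>w. (int (F_stat w), int (spi w), int (NL_stat w)) = (p, q, r)"
  let ?Q = "\<lambda>w. (int (pit w), int (L_stat w), int (grn w)) = (p, q, r)"
  have "card {w \<in> AndI n. ?P w} = card {t \<in> max_trees n. ?P (inorder t)}"
    by (rule card_Collect_bij_betw[OF bij_betw_inorder_AndI])
  \<comment> \<open>The statistics agree tree by tree along the rotation; as it permutes
    \<open>max_trees n\<close>, it can then be dropped.\<close>
  also have "{t \<in> max_trees n. ?P (inorder t)} =
      {t \<in> max_trees n. ?Q (min_word (rotate_spines t))}"
    using statistics_rotate_spines[OF assms] by auto
  also have "card \<dots> = card {t \<in> max_trees n. ?Q (min_word t)}"
    by (rule card_Collect_bij_betw[OF bij_betw_rotate_spines, symmetric])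
  also have "\<dots> = card {w \<in> AndII n. ?Q w}"
    by (rule card_Collect_bij_betw[OF bij_betw_min_word_AndII, symmetric])
  finally show ?thesis .
qed

end
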